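(* Let $\mathbb F$ be an infinite field, $M=(E,r)$ a triangle matroid with distinguished basis $B$, and $\mathcal U=\{U_e\}_{e\in E}$ an extension of a weak $c$-representation of $M$ with respect to $B$. Let $S\subseteq E\setminus B$ be such that every proper subset $S'\subsetneq S$ is full in $\mathcal U$, and let $\mathcal U'=\mathcal I(\mathcal U,S)$ be the inflation (for generic choices). Then for every $T\subseteq E$ disjoint from $S$ and every $Z\subseteq S$: $$r^c_{\mathcal U'}(T\cup Z)=\begin{cases} r^c_{\mathcal U}(T\cup Z)+2|Z|, & Z\subsetneq S,\\ r^c_{\mathcal U}(T\cup S\cup C_M(S))+2|S|-1, & Z=S.\end{cases}$$
   Context: For a subspace arrangement $\mathcal U=\{U_e\}_{e\in E}$ put $U_X=\sum_{e\in X}U_e$, $r^c_{\mathcal U}(X)=\frac1c\dim U_X$. A matroid is $(E,r)$ with $r$ integer-valued, monotone, submodular, $r(X)\le|X|$. A weak $c$-representation of $M$ w.r.t. a basis $B$ is an arrangement $\{A_e\}$ with $\dim A_e=c$, $r^c_{\mathcal A}(X)\le r(X)$ for all $X$, with equality when $|X\setminus B|\le1$. A triangle matroid is a rank-3 matroid $M=(E,r)$ with a distinguished basis $B=\{b^{(1)},b^{(2)},b^{(3)}\}$ such that every element lies in the closure of one of the pairs of elements of $B$. For $S\subseteq E$, $C_M(S)$ is the unique $C\subseteq B$ with $r(S)=r(S\cup C)=r(C)$ if such exists, and $\emptyset$ otherwise. $\mathcal U$ is an extension of a weak $c$-representation of $M$ w.r.t. $B$ if $\{U_e\cap U_B\}_{e}$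 is a weak $c$-representation of $M$ w.r.t. $B$ and $\dim(U_T\cap U_D)\le c(r(T)+r(D)-r(T\cup D))$ for all $T\subseteq E$, $D\subseteq B$. The defect is $\mathrm{de}_{\mathcal U}(S)=c\,r(S)-\dim(U_S\cap U_B)$; $S$ is full if $\mathrm{de}_{\mathcal U}(S)=0$. Generic: a subspace chosen from a family so that each sum with a member of a suitable finite family of subspaces has maximal possible dimension (possible since $\mathbb F$ is infinite). Elementary inflation $\mathcal{EI}_c(\mathcal U,S,d,W')$, for $\mathcal U$ in $V$, $S\subseteq E$, $W'\subseteq V$ a subspace, $d\ge\max(c,\dim W')$: let $\tilde V=V\oplus\mathbb F^{d-\dim W'}$ and $W=W'\oplus\mathbb F^{d-\dim W'}$ (so $\dim W=d$, $W\cap V=W'$); choose generic $c$-dimensional subspaces $W_s\subseteq W$, $s\in S$; the result is the arrangement in $\tilde V$ with $U_s+W_s$ for $s\in S$ and $U_e$ for $e\notin S$. Inflation $\mathcal I(\mathcal U,S)$: set $\mathcal U^1=\mathcal{EI}_c(\mathcal U,S,c(|S|-1)+\mathrm{de}_{\mathcal U}(S),0)$; let $W'$ be a generic $\mathrm{de}_{\mathcal U}(S)$-dimensional subspace of $U^1_{C_M(S)}$ (or $W'=0$ if $C_M(S)=\emptyset$); set $\mathcal I(\mathcal U,S)=\mathcal{EI}_c(\mathcal U^1,S,c|S|,W')$. *)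

theory Defs
  imports "HOL-Analysis.Product_Vector" "HOL-Library.Function_Algebras"
begin

definition matroid :: "'e set \<Rightarrow> ('e set \<Rightarrow> int) \<Rightarrow> bool" where
  "matroid E r \<longleftrightarrow> finite E \<and>
     (\<forall>X. X \<subseteq> E \<longrightarrow> 0 \<le> r X \<and> r X \<le> int (card X)) \<and>
     (\<forall>X Y. X \<subseteq> Y \<and> Y \<subseteq> E \<longrightarrow> r X \<le> r Y) \<and>
     (\<forall>X Y. X \<subseteq> E \<and> Y \<subseteq> E \<longrightarrow> r (X \<union> Y) + r (X \<inter> Y) \<le> r X + r Y)"

definition matroid_basis :: "'e set \<Rightarrow> ('e set \<Rightarrow> int) \<Rightarrow> 'e set \<Rightarrow> bool" where
  "matroid_basis E r B \<longleftrightarrow> B \<subseteq> E \<and> r B = int (card B) \<and> r B = r E"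

definition matroid_closure :: "'e set \<Rightarrow> ('e set \<Rightarrow> int) \<Rightarrow> 'e set \<Rightarrow> 'e set" where
  "matroid_closure E r X = {e \<in> E. r (insert e X) = r X}"

definition triangle_matroid :: "'e set \<Rightarrow> ('e set \<Rightarrow> int) \<Rightarrow> 'e set \<Rightarrow> bool" where
  "triangle_matroid E r B \<longleftrightarrow> matroid E r \<and> r E = 3 \<and> matroid_basis E r B \<and>
     (\<forall>e\<in>E. \<exists>b\<in>B. \<exists>b'\<in>B. b \<noteq> b' \<and> e \<in> matroid_closure E r {b, b'})"

definition CM :: "('e set \<Rightarrow> int) \<Rightarrow> 'e set \<Rightarrow> 'e set \<Rightarrow> 'e set" where
  "CM r B S =
     (if \<exists>!C. C \<subseteq> B \<and> r S = r (S \<union> C) \<and> r (S \<union> C) = r C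
      then THE C. C \<subseteq> B \<and> r S = r (S \<union> C) \<and> r (S \<union> C) = r C
      else {})"

text \<open>
  Vector spaces are given by their scalar multiplication, as in the locale \<^locale>\<open>vector_space\<close>;
  the ambient space \<open>V\<close> of an arrangement is the whole type, which need not be finite-dimensional.
  Since \<open>vector_space.dim\<close> is \<open>0\<close> on infinite-dimensional spaces, members of arrangements are
  explicitly required to be finite-dimensional.
\<close>

definition fin_dim_subspace :: "('f::field \<Rightarrow> 'v::ab_group_add \<Rightarrow> 'v) \<Rightarrow> 'v set \<Rightarrow> bool" where
  "fin_dim_subspace sc A \<longleftrightarrow> (\<exists>X. finite X \<and> A = module.span sc X)"

definition subspace_sum :: "('f::field \<Rightarrow> 'v::ab_group_add \<Rightarrow> 'v) \<Rightarrow> 'v set \<Rightarrow> 'v set \<Rightarrow> 'v set" where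
  "subspace_sum sc A A' = module.span sc (A \<union> A')"

definition arr_sum :: "('f::field \<Rightarrow> 'v::ab_group_add \<Rightarrow> 'v) \<Rightarrow> ('e \<Rightarrow> 'v set) \<Rightarrow> 'e set \<Rightarrow> 'v set" where
  "arr_sum sc U X = module.span sc (\<Union>e\<in>X. U e)"

definition arr_rank ::
  "('f::field \<Rightarrow> 'v::ab_group_add \<Rightarrow> 'v) \<Rightarrow> nat \<Rightarrow> ('e \<Rightarrow> 'v set) \<Rightarrow> 'e set \<Rightarrow> real" where
  "arr_rank sc c U X = real (vector_space.dim sc (arr_sum sc U X)) / real c"

definition subspace_arrangement ::
  "('f::field \<Rightarrow> 'v::ab_group_add \<Rightarrow> 'v) \<Rightarrow> 'e set \<Rightarrow> ('e \<Rightarrow> 'v set) \<Rightarrow> bool" where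
  "subspace_arrangement sc E U \<longleftrightarrow> (\<forall>e\<in>E. fin_dim_subspace sc (U e))"

definition weak_representation ::
  "('f::field \<Rightarrow> 'v::ab_group_add \<Rightarrow> 'v) \<Rightarrow> nat \<Rightarrow> 'e set \<Rightarrow> ('e set \<Rightarrow> int) \<Rightarrow> 'e set
     \<Rightarrow> ('e \<Rightarrow> 'v set) \<Rightarrow> bool" where
  "weak_representation sc c E r B A \<longleftrightarrow>
     matroid_basis E r B \<and> subspace_arrangement sc E A \<and>
     (\<forall>e\<in>E. vector_space.dim sc (A e) = c) \<and>
     (\<forall>X. X \<subseteq> E \<longrightarrow> arr_rank sc c A X \<le> real_of_int (r X)) \<and>
     (\<forall>X. X \<subseteq> E \<and> card (X - B) \<le> 1 \<longrightarrow> arr_rank sc c A X = real_of_int (r X))"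

definition weak_rep_extension ::
  "('f::field \<Rightarrow> 'v::ab_group_add \<Rightarrow> 'v) \<Rightarrow> nat \<Rightarrow> 'e set \<Rightarrow> ('e set \<Rightarrow> int) \<Rightarrow> 'e set
     \<Rightarrow> ('e \<Rightarrow> 'v set) \<Rightarrow> bool" where
  "weak_rep_extension sc c E r B U \<longleftrightarrow>
     subspace_arrangement sc E U \<and>
     weak_representation sc c E r B (\<lambda>e. U e \<inter> arr_sum sc U B) \<and>
     (\<forall>T D. T \<subseteq> E \<and> D \<subseteq> B \<longrightarrow>
        int (vector_space.dim sc (arr_sum sc U T \<inter> arr_sum sc U D))
          \<le> int c * (r T + r D - r (T \<union> D)))"

definition defect ::
  "('f::field \<Rightarrow> 'v::ab_group_add \<Rightarrow> 'v) \<Rightarrow> nat \<Rightarrow> ('e set \<Rightarrow> int) \<Rightarrow> 'e set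
     \<Rightarrow> ('e \<Rightarrow> 'v set) \<Rightarrow> 'e set \<Rightarrow> int" where
  "defect sc c r B U S =
     int c * r S - int (vector_space.dim sc (arr_sum sc U S \<inter> arr_sum sc U B))"

definition full ::
  "('f::field \<Rightarrow> 'v::ab_group_add \<Rightarrow> 'v) \<Rightarrow> nat \<Rightarrow> ('e set \<Rightarrow> int) \<Rightarrow> 'e set
     \<Rightarrow> ('e \<Rightarrow> 'v set) \<Rightarrow> 'e set \<Rightarrow> bool" where
  "full sc c r B U S \<longleftrightarrow> defect sc c r B U S = 0"

definition subspaces_of_dim ::
  "('f::field \<Rightarrow> 'v::ab_group_add \<Rightarrow> 'v) \<Rightarrow> 'v set \<Rightarrow> nat \<Rightarrow> 'v set set" where
  "subspaces_of_dim sc W k =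
     {X. fin_dim_subspace sc X \<and> X \<subseteq> W \<and> vector_space.dim sc X = k}"

definition generic ::
  "('f::field \<Rightarrow> 'v::ab_group_add \<Rightarrow> 'v) \<Rightarrow> 'v set set \<Rightarrow> 'v set set \<Rightarrow> 'v set \<Rightarrow> bool" where
  "generic sc \<A> \<F> X \<longleftrightarrow> X \<in> \<A> \<and>
     (\<forall>F\<in>\<F>. \<forall>Y\<in>\<A>.
        vector_space.dim sc (subspace_sum sc F Y)
          \<le> vector_space.dim sc (subspace_sum sc F X))"

text \<open>
  The external direct sum \<open>V \<oplus> \<bbbF>\<^sup>n\<close> is modelled inside \<open>V \<times> (nat \<Rightarrow> \<bbbF>)\<close>, with \<open>\<bbbF>\<^sup>n\<close> the sequences
  supported on \<open>{..<n}\<close>; a subspace \<open>A\<close> of \<open>V\<close> is identified with \<open>A \<times> {0}\<close>.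
\<close>

definition coord_space :: "nat \<Rightarrow> (nat \<Rightarrow> 'f::field) set" where
  "coord_space n = {x. \<forall>i\<ge>n. x i = 0}"

definition ext_scale ::
  "('f::field \<Rightarrow> 'v::ab_group_add \<Rightarrow> 'v) \<Rightarrow> 'f \<Rightarrow> 'v \<times> (nat \<Rightarrow> 'f) \<Rightarrow> 'v \<times> (nat \<Rightarrow> 'f)" where
  "ext_scale sc = module_prod.scale sc (\<lambda>a x i. a * x i)"

text \<open>
  \<open>elementary_inflation sc c E U S d W' U'\<close>: \<open>U'\<close> is a result of the elementary inflation
  \<open>\<E>\<I>\<^sub>c(U, S, d, W')\<close>, which depends on the choice of the \<open>W\<^sub>s\<close> (here \<open>Ws\<close>).
  The finite family for which \<open>W\<^sub>s\<close> is generic consists of the sums of a \<open>U\<^sub>X\<close> (\<open>X \<subseteq> E\<close>) and of some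
  of the other chosen subspaces. A choice that is generic for a larger family is
  also generic for this one.
\<close>

definition elementary_inflation ::
  "('f::field \<Rightarrow> 'v::ab_group_add \<Rightarrow> 'v) \<Rightarrow> nat \<Rightarrow> 'e set \<Rightarrow> ('e \<Rightarrow> 'v set) \<Rightarrow> 'e set \<Rightarrow> nat
     \<Rightarrow> 'v set \<Rightarrow> ('e \<Rightarrow> ('v \<times> (nat \<Rightarrow> 'f)) set) \<Rightarrow> bool" where
  "elementary_inflation sc c E U S d W' U' \<longleftrightarrow>
     fin_dim_subspace sc W' \<and> max c (vector_space.dim sc W') \<le> d \<and>
     (let sc' = ext_scale sc;
          W = W' \<times> coord_space (d - vector_space.dim sc W')
      in \<exists>Ws.
        (\<forall>s\<in>S. generic sc' (subspaces_of_dim sc' W c)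
           {subspace_sum sc' (arr_sum sc U X \<times> {0}) (arr_sum sc' Ws Y) |X Y.
              X \<subseteq> E \<and> Y \<subseteq> S - {s}}
           (Ws s)) \<and>
        U' = (\<lambda>e. if e \<in> S then subspace_sum sc' (U e \<times> {0}) (Ws e) else U e \<times> {0}))"

definition inflation ::
  "('f::field \<Rightarrow> 'v::ab_group_add \<Rightarrow> 'v) \<Rightarrow> nat \<Rightarrow> 'e set \<Rightarrow> ('e set \<Rightarrow> int) \<Rightarrow> 'e set
     \<Rightarrow> ('e \<Rightarrow> 'v set) \<Rightarrow> 'e set
     \<Rightarrow> ('e \<Rightarrow> (('v \<times> (nat \<Rightarrow> 'f)) \<times> (nat \<Rightarrow> 'f)) set) \<Rightarrow> bool" where
  "inflation sc c E r B U S U' \<longleftrightarrow>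
     (let sc1 = ext_scale sc; de = defect sc c r B U S; C = CM r B S
      in \<exists>U1 W'.
        elementary_inflation sc c E U S (nat (int c * (int (card S) - 1) + de)) {0} U1 \<and>
        (if C = {} then W' = {0}
         else generic sc1 (subspaces_of_dim sc1 (arr_sum sc1 U1 C) (nat de))
                {arr_sum sc1 U1 X |X. X \<subseteq> E} W') \<and>
        elementary_inflation sc1 c E U1 S (c * card S) W' U')"

end

theory Submission
  imports Defs
begin

text \<open>
  A generic \<open>k\<close>-dimensional subspace of \<open>W\<close> raises \<open>dim F\<close> to \<open>min (dim F + k) (dim (F + W))\<close>. Applied
  to the \<open>W\<^sub>s\<close> one after the other, this gives the dimension of every sum in an elementary inflation
  as \<open>min (dim U\<^sub>X + c|X \<inter> S|) (dim (U\<^sub>X + W') + d - dim W')\<close>, and the theorem follows by using this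
  formula twice. The inputs from the matroid are: the defect \<open>\<delta>\<close> of \<open>S\<close> satisfies \<open>0 \<le> \<delta> \<le> c\<close> because
  all proper subsets of \<open>S\<close> are full; \<open>\<delta> = 0\<close> if \<open>C\<^sub>M(S)\<close> is empty; and otherwise
  \<open>U\<^sub>S \<inter> U\<^sub>B \<subseteq> U\<^sub>C\<close> with \<open>C = C\<^sub>M(S)\<close>, so that \<open>W'\<close>, of dimension \<open>\<delta>\<close>, is large enough to make
  \<open>U\<^sub>X + W'\<close> contain \<open>U\<^sub>C\<close> whenever \<open>S \<subseteq> X\<close>.
\<close>

section \<open>Finite-dimensional subspaces\<close>

context vector_space
begin

lemma fin_dim_subspace_subspace: "fin_dim_subspace scale A \<Longrightarrow> subspace A"
  unfolding fin_dim_subspace_def by auto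

lemma fin_dim_subspace_span_eq [simp]: "fin_dim_subspace scale A \<Longrightarrow> span A = A"
  using fin_dim_subspace_subspace by simp

lemma fin_dim_subspace_0: "fin_dim_subspace scale {0}"
  unfolding fin_dim_subspace_def by (rule exI[of _ "{}"]) simp

lemma fin_dim_subspace_mono:
  assumes B: "fin_dim_subspace scale B" and "A \<subseteq> B" "subspace A"
  shows "fin_dim_subspace scale A"
proof -
  obtain X where X: "finite X" "B = span X"
    using B unfolding fin_dim_subspace_def by blast
  obtain I where I: "I \<subseteq> A" "independent I" "A \<subseteq> span I"
    using maximal_independent_subset by blast
  have "finite I"
    using independent_span_bound[of X I] X I assms by blast
  moreover have "A = span I"
    using I assms by (metis span_subspace)
  ultimately show ?thesis
    unfolding fin_dim_subspace_def by blast
qed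

lemma finite_if_independent_in_fin_dim:
  assumes "fin_dim_subspace scale A" "independent I" "I \<subseteq> A"
  shows "finite I"
proof -
  obtain X where "finite X" "A = span X"
    using assms unfolding fin_dim_subspace_def by blast
  then show ?thesis
    using independent_span_bound[of X I] assms by blast
qed

lemma fin_dim_subspace_basis:
  assumes "fin_dim_subspace scale A"
  obtains I where "finite I" "independent I" "span I = A" "card I = dim A"
proof -
  obtain I where I: "I \<subseteq> A" "independent I" "A \<subseteq> span I" "card I = dim A"
    using basis_exists by blast
  moreover have "span I = A"
    using I assms by (meson fin_dim_subspace_subspace span_subspace)
  ultimately show ?thesis
    using that finite_if_independent_in_fin_dim[OF assms] by blast
qed

lemma fin_dim_subspace_Un:
  assumes "fin_dim_subspace scale A" "fin_dim_subspace scale B"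
  shows "fin_dim_subspace scale (span (A \<union> B))"
proof -
  obtain X Y where "finite X" "A = span X" "finite Y" "B = span Y"
    using assms unfolding fin_dim_subspace_def by blast
  moreover have "span (span X \<union> span Y) = span (X \<union> Y)"
    by (auto simp: span_Un span_span)
  ultimately show ?thesis
    unfolding fin_dim_subspace_def by (metis finite_UnI)
qed

lemma dim_le_if_fin_dim:
  assumes "fin_dim_subspace scale B" "A \<subseteq> B"
  shows "dim A \<le> dim B"
  using fin_dim_subspace_basis[OF assms(1)] dim_le_card assms(2) by metis

lemma fin_dim_subspace_eqI:
  assumes B: "fin_dim_subspace scale B" and AB: "A \<subseteq> B" and A: "subspace A"
    and "dim B \<le> dim A"
  shows "A = B"
proof -
  obtain I where I: "finite I" "independent I" "span I = A" "card I = dim A"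
    using fin_dim_subspace_basis fin_dim_subspace_mono[OF B AB A] by blast
  have "I \<subseteq> B"
    using I AB span_superset by blast
  then obtain J where J: "I \<subseteq> J" "J \<subseteq> B" "independent J" "B \<subseteq> span J"
    using maximal_independent_subset_extend I by blast
  then have "finite J"
    using finite_if_independent_in_fin_dim B by blast
  moreover have "card J = dim B"
    using J basis_card_eq_dim by blast
  ultimately have "I = J"
    using J I assms(4) by (metis card_seteq)
  then show ?thesis
    using J I AB by auto
qed

lemma dim_insert_if_fin_dim:
  assumes A: "fin_dim_subspace scale A" and x: "x \<notin> A"
  shows "dim (insert x A) = Suc (dim A)"
proof -
  obtain I where I: "finite I" "independent I" "span I = A" "card I = dim A"
    using fin_dim_subspace_basis[OF A] by blast
  have "independent (insert x I)"
    using I x independent_insertI by blast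
  moreover have "span (insert x I) = span (insert x A)"
    using I by (metis fin_dim_subspace_span_eq A eq_span_insert_eq span_insert)
  moreover have "x \<notin> I"
    using I x span_superset by blast
  ultimately show ?thesis
    using I dim_eq_card[of "insert x I" "insert x A"] by simp
qed

text \<open>A basis \<open>I\<close> of \<open>J\<close> extends to a basis \<open>D\<close> of
  \<open>B\<close>. Adding \<open>D - I\<close> to a basis of \<open>A\<close> then spans the sum.
  As \<open>J\<close> may be smaller than the intersection, only an inequality results;
  \<open>J = {0}\<close> gives subadditivity.\<close>

lemma dim_span_Un_submodular:
  assumes A: "fin_dim_subspace scale A" and B: "fin_dim_subspace scale B"
    and J: "fin_dim_subspace scale J" "J \<subseteq> A" "J \<subseteq> B"
  shows "dim (span (A \<union> B)) + dim J \<le> dim A + dim B"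
proof -
  obtain I where I: "finite I" "independent I" "span I = J" "card I = dim J"
    using fin_dim_subspace_basis J by blast
  obtain K where K: "finite K" "independent K" "span K = A" "card K = dim A"
    using fin_dim_subspace_basis A by blast
  have "I \<subseteq> B"
    using I J span_superset by blast
  then obtain D where D: "I \<subseteq> D" "D \<subseteq> B" "independent D" "B \<subseteq> span D"
    using maximal_independent_subset_extend I by blast
  have finD: "finite D"
    using finite_if_independent_in_fin_dim B D by blast
  have cD: "card D = dim B"
    using D basis_card_eq_dim by blast
  have "I \<subseteq> span K"
    using I J K span_superset by blast
  then have "D \<subseteq> span (K \<union> (D - I))"
    using span_superset[of "K \<union> (D - I)"] span_mono[of K "K \<union> (D - I)"] by blast
  then have "span D \<subseteq> span (K \<union> (D - I))"
    by (simp add: span_minimal)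
  moreover have "A \<subseteq> span (K \<union> (D - I))"
    using K span_mono[of K "K \<union> (D - I)"] by blast
  ultimately have "span (A \<union> B) \<subseteq> span (K \<union> (D - I))"
    using D by (intro span_minimal) auto
  then have "dim (span (A \<union> B)) \<le> card (K \<union> (D - I))"
    by (rule dim_le_card) (use K finD in simp)
  also have "\<dots> \<le> card K + (card D - card I)"
    using card_Un_le[of K "D - I"] I D by (simp add: card_Diff_subset)
  finally show ?thesis
    using I K cD card_mono[OF finD D(1)] by linarith
qed

text \<open>The right-hand side bounds the dimension for every \<open>k\<close>-dimensional subspace
  of \<open>W\<close>. A generic \<open>X\<close> attains it because some competitor
  \<open>Y\<close>, built from a basis adapted to \<open>F\<close>, does.\<close>

lemma dim_sum_generic:
  assumes F: "fin_dim_subspace scale F" and W: "fin_dim_subspace scale W"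
    and X: "generic scale (subspaces_of_dim scale W k) \<F> X" and "F \<in> \<F>"
  shows "dim (subspace_sum scale F X) = min (dim F + k) (dim (subspace_sum scale F W))"
proof -
  have X1: "fin_dim_subspace scale X" "X \<subseteq> W" "dim X = k"
    using X unfolding generic_def subspaces_of_dim_def by auto
  have FW: "fin_dim_subspace scale (span (F \<union> W))"
    using fin_dim_subspace_Un F W by blast
  have kW: "k \<le> dim W"
    using dim_le_if_fin_dim[OF W X1(2)] X1 by simp
  obtain I where I: "finite I" "independent I" "span I = F" "card I = dim F"
    using fin_dim_subspace_basis F by blast
  obtain J where J: "I \<subseteq> J" "J \<subseteq> I \<union> W" "independent J" "I \<union> W \<subseteq> span J"
    using maximal_independent_subset_extend[of I "I \<union> W"] I by blast
  have IF: "I \<subseteq> F"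
    using I span_superset by blast
  have sJ: "span J = span (F \<union> W)"
  proof -
    have "J \<subseteq> span (F \<union> W)"
      using J IF span_superset[of "F \<union> W"] by blast
    moreover have "F \<subseteq> span J"
      using I J span_mono by blast
    ultimately show ?thesis
      using J by (metis Un_least le_sup_iff span_eq)
  qed
  have finJ: "finite J"
    using finite_if_independent_in_fin_dim[OF FW J(3)] sJ span_superset by blast
  have cJ: "card J = dim (span (F \<union> W))"
    using J(3) sJ by (metis dim_span_eq_card_independent)
  \<comment> \<open>\<open>D\<close> lies in \<open>W\<close> and is a basis of the sum of
    \<open>F\<close> and \<open>W\<close> modulo \<open>F\<close>. So \<open>card D\<close> is the
    largest possible gain over \<open>dim F\<close>.\<close>
  define D where "D = J - I"
  have D: "D \<subseteq> W" "independent D" "finite D" "card J = card I + card D"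
    using J finJ independent_mono[of J D] I card_mono[OF finJ J(1)]
    by (auto simp: D_def card_Diff_subset)
  have "\<exists>Y. Y \<in> subspaces_of_dim scale W k \<and> min (dim F + k) (dim (span (F \<union> W))) \<le> dim (span (F \<union> Y))"
  proof (cases "k \<le> card D")
    case True
    then obtain D' where D': "D' \<subseteq> D" "card D' = k"
      using obtain_subset_with_card_n by blast
    have indD': "independent D'"
      using D D' independent_mono by blast
    have "span D' \<subseteq> W"
      using D D' W by (meson fin_dim_subspace_subspace order_trans span_minimal)
    then have "span D' \<in> subspaces_of_dim scale W k"
      using D D' indD' fin_dim_subspace_mono[OF W, of "span D'"]
      by (auto simp: subspaces_of_dim_def dim_eq_card_independent)
    moreover have "dim F + k \<le> dim (span (F \<union> span D'))"
    proof -
      have "independent (I \<union> D')"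
        using J D' D_def independent_mono[of J "I \<union> D'"] by blast
      then have "dim (span (I \<union> D')) = card (I \<union> D')"
        by (rule dim_span_eq_card_independent)
      also have "\<dots> = dim F + k"
        using I D D' D_def finite_subset[of D' D] by (subst card_Un_disjoint) auto
      finally have "dim (span (I \<union> D')) = dim F + k" .
      moreover have "span (I \<union> D') \<subseteq> span (F \<union> span D')"
        using IF span_superset[of D'] by (intro span_mono) blast
      moreover have "fin_dim_subspace scale (span (F \<union> span D'))"
        using fin_dim_subspace_Un F fin_dim_subspace_mono[OF W \<open>span D' \<subseteq> W\<close>] by simp
      ultimately show ?thesis
        using dim_le_if_fin_dim by metis
    qed
    ultimately show ?thesis
      by (meson min.coboundedI1)
  next
    case False
    \<comment> \<open>Here \<open>D\<close> is too small for a \<open>k\<close>-dimensional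
      competitor, so it is filled up inside a basis of \<open>W\<close>. Containing \<open>D\<close>
      already makes the sum with \<open>F\<close> as large as possible.\<close>
    obtain L where L: "D \<subseteq> L" "L \<subseteq> W" "independent L" "W \<subseteq> span L"
      using maximal_independent_subset_extend D by blast
    have cL: "finite L" "card L = dim W"
      using finite_if_independent_in_fin_dim[OF W] L basis_card_eq_dim by auto
    obtain D' where D': "D \<subseteq> D'" "D' \<subseteq> L" "card D' = k"
      using exists_subset_between[of D k L] False kW L cL by auto
    have indD': "independent D'"
      using L D' independent_mono by blast
    have "span D' \<subseteq> W"
      using L D' W by (meson fin_dim_subspace_subspace order_trans span_minimal)
    then have "span D' \<in> subspaces_of_dim scale W k"
      using D' indD' fin_dim_subspace_mono[OF W, of "span D'"]
      by (auto simp: subspaces_of_dim_def dim_eq_card_independent)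
    moreover have "dim (span (F \<union> W)) \<le> dim (span (F \<union> span D'))"
    proof -
      have "J \<subseteq> F \<union> span D'"
        using IF D' D_def span_superset[of D'] by blast
      then have "span (F \<union> W) \<subseteq> span (F \<union> span D')"
        using sJ span_mono by metis
      moreover have "fin_dim_subspace scale (span (F \<union> span D'))"
        using fin_dim_subspace_Un F fin_dim_subspace_mono[OF W \<open>span D' \<subseteq> W\<close>] by simp
      ultimately show ?thesis
        using dim_le_if_fin_dim by metis
    qed
    ultimately show ?thesis
      by (meson min.coboundedI2)
  qed
  then have "min (dim F + k) (dim (span (F \<union> W))) \<le> dim (span (F \<union> X))"
    using X \<open>F \<in> \<F>\<close> unfolding generic_def subspace_sum_def by (meson order_trans)
  moreover have "dim (span (F \<union> X)) \<le> dim (span (F \<union> W))"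
    using dim_le_if_fin_dim[OF FW] span_mono X1 by (metis Un_mono order_refl)
  moreover have "dim (span (F \<union> X)) \<le> dim F + k"
    using dim_span_Un_submodular[OF F X1(1) fin_dim_subspace_0] X1 F
      fin_dim_subspace_subspace subspace_0 by force
  ultimately show ?thesis
    unfolding subspace_sum_def by linarith
qed

section \<open>Sums of members of an arrangement\<close>

lemma fin_dim_arr_sum:
  assumes "finite X" "\<And>e. e \<in> X \<Longrightarrow> fin_dim_subspace scale (U e)"
  shows "fin_dim_subspace scale (arr_sum scale U X)"
  using assms
proof (induction X)
  case empty
  then show ?case
    by (simp add: arr_sum_def fin_dim_subspace_0)
next
  case (insert x X)
  have "span (\<Union>e\<in>insert x X. U e) = span (U x \<union> span (\<Union>e\<in>X. U e))"
    by (auto simp: span_Un span_span)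
  with insert fin_dim_subspace_Un show ?case
    by (simp add: arr_sum_def)
qed

lemma span_Un_span: "span (span A \<union> B) = span (A \<union> B)" "span (A \<union> span B) = span (A \<union> B)"
  by (simp_all add: span_Un span_span)

lemma subspace_sum_assoc:
  "subspace_sum scale (subspace_sum scale A B) C = subspace_sum scale A (subspace_sum scale B C)"
  by (simp add: subspace_sum_def span_Un_span Un_assoc)

lemma arr_sum_Un:
  "arr_sum scale U (X \<union> Y) = subspace_sum scale (arr_sum scale U X) (arr_sum scale U Y)"
  by (simp add: arr_sum_def subspace_sum_def span_Un_span)

lemma arr_sum_mono: "X \<subseteq> Y \<Longrightarrow> arr_sum scale U X \<subseteq> arr_sum scale U Y"
  unfolding arr_sum_def by (intro span_mono) blast

text \<open>The sum over \<open>X \<inter> Y\<close> serves as the common subspace; it may be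
  strictly smaller than the intersection of the two sums.\<close>

lemma dim_arr_sum_submodular:
  assumes "finite X" "finite Y" "\<And>e. e \<in> X \<union> Y \<Longrightarrow> fin_dim_subspace scale (U e)"
  shows "dim (arr_sum scale U (X \<union> Y)) + dim (arr_sum scale U (X \<inter> Y))
    \<le> dim (arr_sum scale U X) + dim (arr_sum scale U Y)"
  using assms arr_sum_mono[of "X \<inter> Y" X U] arr_sum_mono[of "X \<inter> Y" Y U]
  unfolding arr_sum_Un subspace_sum_def
  by (intro dim_span_Un_submodular fin_dim_arr_sum) auto

end

section \<open>Elementary inflations\<close>

lemma vector_space_coord: "vector_space (\<lambda>(a::'f::field) (x::nat \<Rightarrow> 'f) i. a * x i)"
  by unfold_locales (auto simp: fun_eq_iff algebra_simps)

lemma vector_space_prod_coord: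
  fixes sc :: "'f::field \<Rightarrow> 'v::ab_group_add \<Rightarrow> 'v"
  assumes "vector_space sc"
  shows "vector_space_prod sc (\<lambda>(a::'f) (x::nat \<Rightarrow> 'f) i. a * x i)"
  using assms vector_space_coord[where 'f = 'f]
  by (simp add: vector_space_prod_def vector_space_pair_def)

lemma ext_scale_Pair:
  fixes sc :: "'f::field \<Rightarrow> 'v::ab_group_add \<Rightarrow> 'v"
  assumes "vector_space sc"
  shows "ext_scale sc a (v, x) = (sc a v, \<lambda>i. a * x i)"
proof -
  interpret vector_space_prod sc "\<lambda>(a::'f) (x::nat \<Rightarrow> 'f) i. a * x i"
    using assms by (rule vector_space_prod_coord)
  show ?thesis
    unfolding ext_scale_def by (rule scale_prod)
qed

lemma vector_space_ext_scale:
  fixes sc :: "'f::field \<Rightarrow> 'v::ab_group_add \<Rightarrow> 'v"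
  assumes "vector_space sc"
  shows "vector_space (ext_scale sc)"
proof -
  interpret vector_space_prod sc "\<lambda>(a::'f) (x::nat \<Rightarrow> 'f) i. a * x i"
    using assms by (rule vector_space_prod_coord)
  show ?thesis
    unfolding ext_scale_def by (rule p.vector_space_axioms)
qed

lemma span_Times_0:
  fixes sc :: "'f::field \<Rightarrow> 'v::ab_group_add \<Rightarrow> 'v"
  assumes "vector_space sc"
  shows "module.span (ext_scale sc) (A \<times> {0}) = module.span sc A \<times> {0}"
proof -
  interpret vector_space_prod sc "\<lambda>(a::'f) (x::nat \<Rightarrow> 'f) i. a * x i"
    using assms by (rule vector_space_prod_coord)
  show ?thesis
    unfolding ext_scale_def by (rule span_Times_sing2)
qed

lemma dim_Times_0:
  assumes "vector_space sc" and A: "fin_dim_subspace sc A"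
  shows "fin_dim_subspace (ext_scale sc) (A \<times> {0})"
    and "vector_space.dim (ext_scale sc) (A \<times> {0}) = vector_space.dim sc A"
proof -
  interpret V: vector_space sc by fact
  interpret P: vector_space "ext_scale sc"
    using assms vector_space_ext_scale by blast
  obtain I where I: "finite I" "V.independent I" "V.span I = A" "card I = V.dim A"
    using V.fin_dim_subspace_basis A by blast
  interpret L: Vector_Spaces.linear sc "ext_scale sc" "\<lambda>x. (x, 0)"
    by unfold_locales (auto simp: ext_scale_Pair[OF assms(1)] fun_eq_iff)
  have sp: "P.span (I \<times> {0}) = A \<times> {0}"
    using span_Times_0[OF assms(1)] I by simp
  then show "fin_dim_subspace (ext_scale sc) (A \<times> {0})"
    unfolding fin_dim_subspace_def using I by (metis finite.emptyI finite.insertI finite_cartesian_product)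
  have "P.independent ((\<lambda>x. (x, 0)) ` I)"
    by (rule L.independent_injective_image) (use I in \<open>auto simp: inj_on_def\<close>)
  moreover have "(\<lambda>x. (x, 0)) ` I = I \<times> {0}"
    by auto
  ultimately have "P.dim (A \<times> {0}) = card (I \<times> {0::nat \<Rightarrow> 'a})"
    using sp P.dim_span_eq_card_independent by metis
  then show "P.dim (A \<times> {0}) = V.dim A"
    using I by (simp add: card_cartesian_product)
qed

text \<open>By induction: passing from \<open>m\<close> to \<open>Suc m\<close> coordinates adjoins
  a single new unit vector.\<close>

lemma dim_Times_coord_space:
  assumes "vector_space sc" and A: "fin_dim_subspace sc A"
  shows "fin_dim_subspace (ext_scale sc) (A \<times> coord_space m)
    \<and> vector_space.dim (ext_scale sc) (A \<times> coord_space m) = vector_space.dim sc A + m"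
proof (induction m)
  case 0
  have "coord_space 0 = {0::nat \<Rightarrow> 'a}"
    by (auto simp: coord_space_def fun_eq_iff)
  then show ?case
    using dim_Times_0[OF assms] by simp
next
  case (Suc m)
  interpret V: vector_space sc by fact
  interpret P: vector_space "ext_scale sc"
    using assms vector_space_ext_scale by blast
  define y :: "'b \<times> (nat \<Rightarrow> 'a)" where "y = (0, \<lambda>i. if i = m then 1 else 0)"
  let ?A = "A \<times> (coord_space m :: (nat \<Rightarrow> 'a) set)"
  have fd: "fin_dim_subspace (ext_scale sc) ?A"
    using Suc by blast
  have step: "P.span (insert y ?A) = A \<times> coord_space (Suc m)"
  proof (rule set_eqI)
    fix z :: "'b \<times> (nat \<Rightarrow> 'a)"
    obtain a x where z: "z = (a, x)"
      by (cases z)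
    have "z \<in> P.span (insert y ?A) \<longleftrightarrow> (\<exists>k. z - ext_scale sc k y \<in> ?A)"
      unfolding P.span_insert P.fin_dim_subspace_span_eq[OF fd] by simp
    \<comment> \<open>Subtracting a multiple of \<open>y\<close> changes only coordinate
      \<open>m\<close>, and \<open>k = x m\<close> is the multiple that clears it.\<close>
    also have "\<dots> \<longleftrightarrow> a \<in> A \<and> (\<exists>k. \<forall>i\<ge>m. x i - k * (if i = m then 1 else 0) = 0)"
      by (simp add: z y_def ext_scale_Pair[OF assms(1)] coord_space_def)
    also have "\<dots> \<longleftrightarrow> a \<in> A \<and> (\<forall>i\<ge>Suc m. x i = 0)"
    proof -
      have "(\<exists>k. \<forall>i\<ge>m. x i - k * (if i = m then 1 else 0) = 0) \<longleftrightarrow> (\<forall>i\<ge>Suc m. x i = 0)"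
      proof
        assume "\<forall>i\<ge>Suc m. x i = 0"
        then show "\<exists>k. \<forall>i\<ge>m. x i - k * (if i = m then 1 else 0) = 0"
          by (intro exI[of _ "x m"]) (simp add: Suc_le_eq)
      qed fastforce
      then show ?thesis
        by blast
    qed
    also have "\<dots> \<longleftrightarrow> z \<in> A \<times> coord_space (Suc m)"
      by (simp add: z coord_space_def)
    finally show "z \<in> P.span (insert y ?A) \<longleftrightarrow> z \<in> A \<times> coord_space (Suc m)" .
  qed
  have "y \<notin> ?A"
    by (auto simp: y_def coord_space_def)
  then have "P.dim (insert y ?A) = Suc (P.dim ?A)"
    using P.dim_insert_if_fin_dim fd by blast
  then have "P.dim (A \<times> coord_space (Suc m)) = V.dim A + Suc m"
    using Suc step by (metis P.dim_span add_Suc_right)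
  moreover have "fin_dim_subspace (ext_scale sc) (P.span (insert y ?A))"
  proof -
    obtain X where "finite X" "?A = P.span X"
      using fd unfolding fin_dim_subspace_def by blast
    moreover have "P.span (insert y (P.span X)) = P.span (insert y X)"
      by (simp add: P.span_insert P.span_span)
    ultimately show ?thesis
      unfolding fin_dim_subspace_def by (metis finite_insert)
  qed
  ultimately show ?case
    using step by simp
qed

text \<open>The \<open>Ws s\<close> are added one at a time. By \<open>mem\<close>, each is generic
  against \<open>F\<close> plus those added before, so it gains \<open>c\<close> until the sum with
  all of \<open>W\<close> is reached. That ceiling does not move, since every \<open>Ws s\<close>
  lies in \<open>W\<close>.\<close>

lemma dim_sum_arr_sum_generic:
  assumes "vector_space sc" and F: "fin_dim_subspace sc F" and W: "fin_dim_subspace sc W"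
    and "finite Y"
    and gen: "\<And>s. s \<in> S \<Longrightarrow> generic sc (subspaces_of_dim sc W c) (\<F> s) (Ws s)"
    and mem: "\<And>s Y. s \<in> S \<Longrightarrow> Y \<subseteq> S - {s} \<Longrightarrow> subspace_sum sc F (arr_sum sc Ws Y) \<in> \<F> s"
    and "Y \<subseteq> S"
  shows "vector_space.dim sc (subspace_sum sc F (arr_sum sc Ws Y))
    = min (vector_space.dim sc F + c * card Y) (vector_space.dim sc (subspace_sum sc F W))"
proof -
  interpret V: vector_space sc by fact
  have Ws: "fin_dim_subspace sc (Ws s)" "Ws s \<subseteq> W" if "s \<in> S" for s
    using gen[OF that] unfolding generic_def subspaces_of_dim_def by auto
  show ?thesis
    using \<open>finite Y\<close> \<open>Y \<subseteq> S\<close>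
  proof (induction Y)
    case empty
    have "V.span (insert 0 F) = F"
      using F by simp
    moreover have "V.dim F \<le> V.dim (V.span (F \<union> W))"
      using V.dim_le_if_fin_dim V.fin_dim_subspace_Un F W V.span_superset by (metis le_sup_iff)
    ultimately show ?case
      by (simp add: subspace_sum_def arr_sum_def)
  next
    case (insert s Y)
    let ?G = "subspace_sum sc F (arr_sum sc Ws Y)"
    have "fin_dim_subspace sc (arr_sum sc Ws Y)"
      using insert Ws by (intro V.fin_dim_arr_sum) auto
    then have G: "fin_dim_subspace sc ?G"
      unfolding subspace_sum_def using F V.fin_dim_subspace_Un by blast
    have "?G \<in> \<F> s"
      using mem insert by blast
    then have *: "V.dim (subspace_sum sc ?G (Ws s)) = min (V.dim ?G + c) (V.dim (subspace_sum sc ?G W))"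
      using V.dim_sum_generic[OF G W gen] insert by auto
    have "(\<Union>e\<in>Y. Ws e) \<subseteq> W"
      using insert Ws by blast
    then have "arr_sum sc Ws Y \<subseteq> W"
      unfolding arr_sum_def using W by (metis V.fin_dim_subspace_span_eq V.span_mono)
    then have "arr_sum sc Ws Y \<union> W = W"
      by blast
    then have "subspace_sum sc (arr_sum sc Ws Y) W = W"
      using W by (simp add: subspace_sum_def)
    then have "subspace_sum sc ?G W = subspace_sum sc F W"
      by (simp add: V.subspace_sum_assoc)
    moreover have "arr_sum sc Ws (insert s Y) = subspace_sum sc (arr_sum sc Ws Y) (Ws s)"
      using V.arr_sum_Un[of Ws Y "{s}"] Ws insert.prems by (simp add: arr_sum_def)
    then have "subspace_sum sc ?G (Ws s) = subspace_sum sc F (arr_sum sc Ws (insert s Y))"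
      by (simp add: V.subspace_sum_assoc)
    ultimately show ?case
      using * insert by (simp add: min_def algebra_simps)
  qed
qed

text \<open>The first bound is the case of independent \<open>Ws s\<close>. The second is the
  ceiling where they exhaust \<open>W\<close>, whose new coordinates contribute
  \<open>d - dim W'\<close>.\<close>

lemma elementary_inflation_dim:
  assumes "vector_space sc" and "finite E" and U: "subspace_arrangement sc E U" and "S \<subseteq> E"
    and infl: "elementary_inflation sc c E U S d W' U'"
  shows "subspace_arrangement (ext_scale sc) E U'"
    and "\<And>X. X \<subseteq> E \<Longrightarrow> vector_space.dim (ext_scale sc) (arr_sum (ext_scale sc) U' X)
      = min (vector_space.dim sc (arr_sum sc U X) + c * card (X \<inter> S))
          (vector_space.dim sc (subspace_sum sc (arr_sum sc U X) W') + (d - vector_space.dim sc W'))"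
proof -
  interpret V: vector_space sc by fact
  interpret P: vector_space "ext_scale sc"
    using assms vector_space_ext_scale by blast
  define m where "m = d - V.dim W'"
  define W where "W = W' \<times> (coord_space m :: (nat \<Rightarrow> 'a) set)"
  have W': "fin_dim_subspace sc W'"
    using infl unfolding elementary_inflation_def by blast
  obtain Ws where gen: "\<And>s. s \<in> S \<Longrightarrow>
      generic (ext_scale sc) (subspaces_of_dim (ext_scale sc) W c)
        {subspace_sum (ext_scale sc) (arr_sum sc U X \<times> {0}) (arr_sum (ext_scale sc) Ws Y) |X Y.
              X \<subseteq> E \<and> Y \<subseteq> S - {s}} (Ws s)"
    and U': "U' = (\<lambda>e. if e \<in> S then subspace_sum (ext_scale sc) (U e \<times> {0}) (Ws e) else U e \<times> {0})"
    using infl unfolding elementary_inflation_def Let_def W_def m_def by blast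
  have W: "fin_dim_subspace (ext_scale sc) W"
    unfolding W_def using dim_Times_coord_space W' assms(1) by blast
  have Ws: "fin_dim_subspace (ext_scale sc) (Ws s)" if "s \<in> S" for s
    using gen[OF that] unfolding generic_def subspaces_of_dim_def by auto
  have U0: "fin_dim_subspace (ext_scale sc) (U e \<times> {0})" if "e \<in> E" for e
    using U that dim_Times_0 assms(1) unfolding subspace_arrangement_def by blast
  show "subspace_arrangement (ext_scale sc) E U'"
    unfolding subspace_arrangement_def U'
    using U0 Ws P.fin_dim_subspace_Un by (auto simp: subspace_sum_def)
  fix X assume X: "X \<subseteq> E"
  let ?F = "arr_sum sc U X \<times> {0::nat \<Rightarrow> 'a}"
  have fdX: "fin_dim_subspace sc (arr_sum sc U X)"
    using U X \<open>finite E\<close> finite_subset unfolding subspace_arrangement_def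
    by (intro V.fin_dim_arr_sum) auto
  have F: "fin_dim_subspace (ext_scale sc) ?F" "P.dim ?F = V.dim (arr_sum sc U X)"
    using dim_Times_0 fdX assms(1) by auto
  have F_span: "?F = P.span (\<Union>e\<in>X. U e \<times> {0})"
  proof -
    have "(\<Union>e\<in>X. U e \<times> {0::nat \<Rightarrow> 'a}) = (\<Union>e\<in>X. U e) \<times> {0}"
      by auto
    then show ?thesis
      using span_Times_0[OF assms(1)] by (simp add: arr_sum_def)
  qed
  have sum_X: "arr_sum (ext_scale sc) U' X = subspace_sum (ext_scale sc) ?F (arr_sum (ext_scale sc) Ws (X \<inter> S))"
    (is "?L = ?R")
  proof
    have base: "U e \<times> {0} \<subseteq> ?F" if "e \<in> X" for e
      using that P.span_superset[of "\<Union>e\<in>X. U e \<times> {0}"] unfolding F_span by blast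
    have baseW: "Ws e \<subseteq> arr_sum (ext_scale sc) Ws (X \<inter> S)" if "e \<in> X" "e \<in> S" for e
      using that P.span_superset[of "\<Union>e\<in>X \<inter> S. Ws e"] unfolding arr_sum_def by blast
    have "U' e \<subseteq> ?R" if "e \<in> X" for e
    proof (cases "e \<in> S")
      case True
      then show ?thesis
        using base[OF that] baseW[OF that] unfolding U' subspace_sum_def
        by (simp, intro P.span_mono Un_mono)
    next
      case False
      then show ?thesis
        using base[OF that] P.span_superset[of "?F \<union> arr_sum (ext_scale sc) Ws (X \<inter> S)"]
        unfolding U' subspace_sum_def by auto
    qed
    then show "?L \<subseteq> ?R"
      unfolding arr_sum_def[of _ U'] subspace_sum_def
      by (intro P.span_minimal) auto
    have U'_base: "U e \<times> {0} \<subseteq> U' e" "e \<in> S \<Longrightarrow> Ws e \<subseteq> U' e" for e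
      unfolding U' subspace_sum_def using P.span_superset[of "U e \<times> {0} \<union> Ws e"] by auto
    have "?F \<subseteq> ?L" "arr_sum (ext_scale sc) Ws (X \<inter> S) \<subseteq> ?L"
      unfolding F_span unfolding arr_sum_def using U'_base by (intro P.span_mono; blast)+
    then show "?R \<subseteq> ?L"
      unfolding subspace_sum_def arr_sum_def[of _ U'] by (intro P.span_minimal) auto
  qed
  \<comment> \<open>The ceiling is again a product, so its dimension splits into the part in the old
    space and the \<open>m\<close> new coordinates.\<close>
  have FW: "subspace_sum (ext_scale sc) ?F W = subspace_sum sc (arr_sum sc U X) W' \<times> coord_space m"
    (is "?L = ?R")
  proof
    have R: "fin_dim_subspace (ext_scale sc) ?R"
      using dim_Times_coord_space assms(1) V.fin_dim_subspace_Un[OF fdX W']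
      unfolding subspace_sum_def by blast
    have "?F \<union> W \<subseteq> ?R"
      unfolding W_def subspace_sum_def using V.span_superset[of "arr_sum sc U X \<union> W'"]
      by (auto simp: coord_space_def)
    then show "?L \<subseteq> ?R"
      unfolding subspace_sum_def[of "ext_scale sc"]
      using R by (intro P.span_minimal P.fin_dim_subspace_subspace)
    show "?R \<subseteq> ?L"
    proof
      fix z assume "z \<in> ?R"
      then obtain a w x where z: "z = (a + w, x)" "a \<in> arr_sum sc U X" "w \<in> W'" "x \<in> coord_space m"
        using fdX W' by (auto simp: subspace_sum_def V.span_Un)
      then have "z = (a, 0) + (w, x)" "(a, 0) \<in> ?F" "(w, x) \<in> W"
        by (auto simp: W_def)
      then show "z \<in> ?L"
        unfolding subspace_sum_def by (metis P.span_add P.span_base UnI1 UnI2)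
    qed
  qed
  have "P.dim (subspace_sum (ext_scale sc) ?F (arr_sum (ext_scale sc) Ws (X \<inter> S)))
     = min (P.dim ?F + c * card (X \<inter> S)) (P.dim (subspace_sum (ext_scale sc) ?F W))"
    by (rule dim_sum_arr_sum_generic[OF P.vector_space_axioms F(1) W _ gen])
      (use X \<open>S \<subseteq> E\<close> \<open>finite E\<close> in \<open>auto intro: finite_subset\<close>)
  moreover have "P.dim (subspace_sum (ext_scale sc) ?F W) = V.dim (subspace_sum sc (arr_sum sc U X) W') + m"
    unfolding FW
    using dim_Times_coord_space assms(1) V.fin_dim_subspace_Un[OF fdX W']
    unfolding subspace_sum_def by blast
  ultimately show "P.dim (arr_sum (ext_scale sc) U' X)
      = min (V.dim (arr_sum sc U X) + c * card (X \<inter> S))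
          (V.dim (subspace_sum sc (arr_sum sc U X) W') + (d - V.dim W'))"
    using F sum_X by (simp add: m_def)
qed

section \<open>Triangle matroids and defects\<close>

text \<open>A nonempty value can only come from the branch of the definition in which the set exists
  uniquely.\<close>

lemma CM_nonemptyD:
  assumes "CM r B S \<noteq> {}"
  shows "CM r B S \<subseteq> B" "r (S \<union> CM r B S) = r S" "r (CM r B S) = r S"
proof -
  let ?P = "\<lambda>C. C \<subseteq> B \<and> r S = r (S \<union> C) \<and> r (S \<union> C) = r C"
  have ex: "\<exists>!C. ?P C"
    using assms unfolding CM_def by metis
  then have "CM r B S = (THE C. ?P C)"
    unfolding CM_def by simp
  then have "?P (CM r B S)"
    using theI'[OF ex] by simp
  then show "CM r B S \<subseteq> B" "r (S \<union> CM r B S) = r S" "r (CM r B S) = r S"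
    by auto
qed

locale triangle_extension = vector_space scale
  for scale :: "'f::field \<Rightarrow> 'v::ab_group_add \<Rightarrow> 'v" +
  fixes c :: nat and E B :: "'e set" and r :: "'e set \<Rightarrow> int" and U :: "'e \<Rightarrow> 'v set"
  assumes c_pos: "0 < c"
    and triangle: "triangle_matroid E r B"
    and extension: "weak_rep_extension scale c E r B U"
begin

abbreviation "UU \<equiv> arr_sum scale U"
abbreviation "A \<equiv> \<lambda>e. U e \<inter> UU B"
abbreviation "AA \<equiv> arr_sum scale A"

section \<open>Ranks and dimensions in the extension\<close>

lemma finite_E: "finite E"
  and r_nonneg: "X \<subseteq> E \<Longrightarrow> 0 \<le> r X"
  and r_le_card: "X \<subseteq> E \<Longrightarrow> r X \<le> int (card X)"
  and r_mono: "X \<subseteq> Y \<Longrightarrow> Y \<subseteq> E \<Longrightarrow> r X \<le> r Y"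
  and r_submodular: "X \<subseteq> E \<Longrightarrow> Y \<subseteq> E \<Longrightarrow> r (X \<union> Y) + r (X \<inter> Y) \<le> r X + r Y"
  and r_E: "r E = 3"
  and B_E: "B \<subseteq> E"
  and r_B: "r B = 3"
  and card_B: "card B = 3"
  using triangle unfolding triangle_matroid_def matroid_def matroid_basis_def by auto

lemma r_empty: "r {} = 0"
  using r_nonneg[of "{}"] r_le_card[of "{}"] by simp

lemma r_Un_le: "X \<subseteq> E \<Longrightarrow> Y \<subseteq> E \<Longrightarrow> r (X \<union> Y) \<le> r X + r Y"
  using r_submodular[of X Y] r_nonneg[of "X \<inter> Y"] by (simp add: le_infI1)

lemma r_Un_B: "X \<subseteq> E \<Longrightarrow> r (X \<union> B) = 3"
  using r_mono[of "X \<union> B" E] r_mono[of B "X \<union> B"] B_E r_E r_B by auto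

lemma finite_B: "finite B"
  using finite_E B_E finite_subset by blast

text \<open>\<open>C\<close> and \<open>B - C\<close> have ranks at most their cardinalities, yet
  these ranks must add up to at least 3, so both bounds are tight.\<close>

lemma r_subset_B:
  assumes "C \<subseteq> B"
  shows "r C = int (card C)"
proof -
  have "r B \<le> r C + r (B - C)"
    using r_Un_le[of C "B - C"] assms B_E by (auto simp: Un_absorb1)
  moreover have "r (B - C) \<le> int (card (B - C))" "r C \<le> int (card C)"
    using assms B_E by (auto intro!: r_le_card)
  moreover have "card (B - C) + card C = 3"
    using assms card_B finite_B card_mono[OF finite_B assms]
    by (simp add: card_Diff_subset finite_subset)
  ultimately show ?thesis
    using r_B by linarith
qed

lemma fin_dim_U: "e \<in> E \<Longrightarrow> fin_dim_subspace scale (U e)"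
  using extension unfolding weak_rep_extension_def subspace_arrangement_def by blast

lemma fin_dim_UU: "X \<subseteq> E \<Longrightarrow> fin_dim_subspace scale (UU X)"
  using fin_dim_U finite_E finite_subset by (intro fin_dim_arr_sum) blast+

lemma fin_dim_UU_Int: "X \<subseteq> E \<Longrightarrow> fin_dim_subspace scale (UU X \<inter> UU Y)"
  by (rule fin_dim_subspace_mono[OF fin_dim_UU])
    (auto simp: arr_sum_def intro: subspace_inter)

lemma fin_dim_A: "e \<in> E \<Longrightarrow> fin_dim_subspace scale (A e)"
  by (rule fin_dim_subspace_mono[OF fin_dim_U])
    (auto simp: arr_sum_def intro: subspace_inter fin_dim_subspace_subspace fin_dim_U)

lemma dim_A: "e \<in> E \<Longrightarrow> dim (A e) = c"
  using extension unfolding weak_rep_extension_def weak_representation_def by blast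

lemma dim_AA:
  assumes "X \<subseteq> E" "card (X - B) \<le> 1"
  shows "int (dim (AA X)) = int c * r X"
proof -
  have "real (dim (AA X)) / real c = real_of_int (r X)"
    using extension assms
    unfolding weak_rep_extension_def weak_representation_def arr_rank_def by blast
  then have "real (dim (AA X)) = real c * real_of_int (r X)"
    using c_pos by (simp add: field_simps)
  then have "real_of_int (int (dim (AA X))) = real_of_int (int c * r X)"
    by simp
  then show ?thesis
    by (simp only: of_int_eq_iff)
qed

text \<open>Matroids may have loops; here the representation rules them out, because
  \<open>A e\<close> has dimension \<open>c\<close> and its rank is exact on sets with at most one
  element outside \<open>B\<close>.\<close>

lemma r_single:
  assumes "e \<in> E"
  shows "r {e} = 1"
proof -
  have "card ({e} - B) \<le> 1"
    using card_mono[of "{e}" "{e} - B"] by simp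
  then have "int (dim (AA {e})) = int c * r {e}"
    using assms dim_AA by simp
  moreover have "AA {e} = A e"
    unfolding arr_sum_def[of _ A] using fin_dim_A assms by simp
  ultimately show ?thesis
    using dim_A[OF assms] c_pos by simp
qed

lemma r_pos:
  assumes "X \<subseteq> E" "X \<noteq> {}"
  shows "1 \<le> r X"
proof -
  obtain e where "e \<in> X"
    using assms by blast
  then show ?thesis
    using r_mono[of "{e}" X] r_single[of e] assms by auto
qed

text \<open>For \<open>e \<in> B\<close> the intersection with \<open>UU B\<close> changes nothing,
  so \<open>A\<close> and \<open>U\<close> agree on \<open>B\<close> and the exact rank of
  \<open>A\<close> carries over.\<close>

lemma dim_UU_subset_B:
  assumes "C \<subseteq> B"
  shows "int (dim (UU C)) = int c * r C"
proof -
  have "U e \<subseteq> UU B" if "e \<in> B" for e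
    using that span_superset[of "\<Union>e\<in>B. U e"] unfolding arr_sum_def by blast
  then have "(\<Union>e\<in>C. A e) = (\<Union>e\<in>C. U e)"
    using assms by blast
  then have "AA C = UU C"
    unfolding arr_sum_def[of _ A] arr_sum_def[of _ _ C] by simp
  moreover have "C - B = {}"
    using assms by blast
  ultimately show ?thesis
    using dim_AA[of C] assms B_E by (metis card.empty order_trans zero_le_one)
qed

text \<open>This is the extension inequality for \<open>D = B\<close>, where \<open>r B\<close> and
  \<open>r (X \<union> B)\<close> cancel. It makes defects nonnegative.\<close>

lemma dim_Int_UU_B_le:
  assumes "X \<subseteq> E"
  shows "int (dim (UU X \<inter> UU B)) \<le> int c * r X"
proof -
  have "int (dim (UU X \<inter> UU B)) \<le> int c * (r X + r B - r (X \<union> B))"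
    using extension assms unfolding weak_rep_extension_def by blast
  then show ?thesis
    using r_Un_B[OF assms] r_B by simp
qed

lemma AA_subset: "AA X \<subseteq> UU X \<inter> UU B"
  unfolding arr_sum_def[of _ A]
proof (rule span_minimal)
  show "(\<Union>e\<in>X. A e) \<subseteq> UU X \<inter> UU B"
    using span_superset[of "\<Union>e\<in>X. U e"] unfolding arr_sum_def by blast
  show "subspace (UU X \<inter> UU B)"
    unfolding arr_sum_def by (intro subspace_inter subspace_span)
qed

section \<open>Bounds on the defect, and its relation to \<open>CM\<close>\<close>

abbreviation "de \<equiv> defect scale c r B U"

lemma defect_nonneg: "X \<subseteq> E \<Longrightarrow> 0 \<le> de X"
  using dim_Int_UU_B_le unfolding defect_def by simp

lemma defect_singleton:
  assumes "s \<in> E"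
  shows "de {s} = 0"
proof -
  have "UU {s} = U s"
    unfolding arr_sum_def using fin_dim_U assms by simp
  then show ?thesis
    using r_single[OF assms] dim_A[OF assms] unfolding defect_def by simp
qed

text \<open>Fullness of \<open>X\<close> already places \<open>c * r X\<close> dimensions inside
  \<open>UU S \<inter> UU B\<close>.\<close>

lemma defect_le_rank_drop:
  assumes "S \<subseteq> E" "X \<subseteq> S" "full scale c r B U X"
  shows "de S \<le> int c * (r S - r X)"
proof -
  have "UU X \<inter> UU B \<subseteq> UU S \<inter> UU B"
    using arr_sum_mono assms by blast
  then have "dim (UU X \<inter> UU B) \<le> dim (UU S \<inter> UU B)"
    using dim_le_if_fin_dim fin_dim_UU_Int assms by blast
  then show ?thesis
    using assms(3) unfolding full_def defect_def by (simp add: algebra_simps)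
qed

text \<open>Deleting one element leaves a full set and lowers the rank by at most 1.\<close>

lemma defect_le:
  assumes "S \<subseteq> E" "S \<noteq> {}" "\<And>S'. S' \<subset> S \<Longrightarrow> full scale c r B U S'"
  shows "de S \<le> int c"
proof -
  obtain s where s: "s \<in> S"
    using assms by blast
  then have "de S \<le> int c * (r S - r (S - {s}))"
    using assms(1) by (intro defect_le_rank_drop assms(3)) auto
  also have "\<dots> \<le> int c * 1"
  proof (rule mult_left_mono)
    have "r S \<le> r (S - {s}) + r {s}"
      using r_Un_le[of "S - {s}" "{s}"] s assms by (auto simp: insert_absorb)
    moreover have "r {s} = 1"
      using r_single s assms by blast
    ultimately show "r S - r (S - {s}) \<le> 1"
      by linarith
  qed simp
  finally show ?thesis
    by simp
qed

text \<open>Only uniqueness needs work. If \<open>C\<close> and \<open>C'\<close> both qualify,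
  submodularity over \<open>S\<close> shows that \<open>C \<union> C'\<close> has rank at most
  \<open>r S\<close>. Rank is cardinality inside \<open>B\<close>, so the union equals each of them.
  The set is nonempty because \<open>r S\<close> is positive.\<close>

lemma CM_nonemptyI:
  assumes S: "S \<subseteq> E" "S \<noteq> {}" and C: "C \<subseteq> B" "r (S \<union> C) = r S" "r C = r S"
  shows "CM r B S \<noteq> {}"
proof -
  have unique: "C' = C" if C': "C' \<subseteq> B" "r (S \<union> C') = r S" "r C' = r S" for C'
  proof -
    have "r (S \<union> C \<union> (S \<union> C')) + r ((S \<union> C) \<inter> (S \<union> C')) \<le> r (S \<union> C) + r (S \<union> C')"
      using S C C' B_E by (intro r_submodular) auto
    moreover have "r S \<le> r ((S \<union> C) \<inter> (S \<union> C'))"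
      using S C B_E by (intro r_mono) auto
    moreover have "r (C \<union> C') \<le> r (S \<union> C \<union> (S \<union> C'))"
      using S C C' B_E by (intro r_mono) auto
    ultimately have "r (C \<union> C') \<le> r S"
      using C C' by linarith
    then have le: "card (C \<union> C') \<le> card C" "card (C \<union> C') \<le> card C'"
      using r_subset_B[of "C \<union> C'"] r_subset_B[of C] r_subset_B[of C'] C C' by simp_all
    have "finite (C \<union> C')"
      using C C' finite_B finite_subset by blast
    then have "C = C \<union> C'" "C' = C \<union> C'"
      using le by (intro card_seteq; simp)+
    then show ?thesis
      by simp
  qed
  let ?P = "\<lambda>C. C \<subseteq> B \<and> r S = r (S \<union> C) \<and> r (S \<union> C) = r C"
  have ex: "\<exists>!C. ?P C"
  proof (rule ex1I)
    show "?P C"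
      using C by simp
    show "C' = C" if "?P C'" for C'
      using that by (intro unique) simp_all
  qed
  then have "?P (CM r B S)"
    unfolding CM_def using theI'[OF ex] by simp
  then show ?thesis
    using r_empty r_pos[OF S] by auto
qed

text \<open>
  A positive defect forces \<open>S\<close> to be independent. If it consists of two elements on different sides
  of the triangle, then already \<open>A\<close> spans \<open>2c\<close> dimensions on it, so the defect vanishes.
\<close>

lemma CM_nonempty_if_defect_pos:
  assumes S: "S \<subseteq> E" and full: "\<And>S'. S' \<subset> S \<Longrightarrow> full scale c r B U S'"
    and card_S: "2 \<le> card S" and pos: "0 < de S"
  shows "CM r B S \<noteq> {}"
proof -
  have ne: "S \<noteq> {}"
    using card_S by auto
  have finS: "finite S"
    using S finite_E finite_subset by blast
  \<comment> \<open>This is the independence of \<open>S\<close>: a deletion preserving the rank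
    would force the defect of \<open>S\<close> to be 0.\<close>
  have drop: "r (S - {s}) < r S" if "s \<in> S" for s
  proof -
    have "de S \<le> int c * (r S - r (S - {s}))"
      using that S by (intro defect_le_rank_drop full) auto
    then have "0 < int c * (r S - r (S - {s}))"
      using pos by linarith
    then show ?thesis
      by (simp add: zero_less_mult_iff)
  qed
  have "r S \<le> 3"
    using r_mono[OF S] r_E by simp
  obtain e f where ef: "e \<in> S" "f \<in> S" "e \<noteq> f"
    using card_S card_le_Suc0_iff_eq[OF finS] by force
  have "S - {e} \<noteq> {}"
    using ef by blast
  then have "1 \<le> r (S - {e})"
    using r_pos[of "S - {e}"] S by auto
  then have r2: "2 \<le> r S"
    using drop[OF ef(1)] by linarith
  show ?thesis
  proof (cases "r S = 3")
    case True
    then show ?thesis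
      using CM_nonemptyI[of S B] S ne r_Un_B r_B by simp
  next
    case False
    then have rS: "r S = 2"
      using r2 \<open>r S \<le> 3\<close> by linarith
    \<comment> \<open>With a third element, submodularity for \<open>S - {e}\<close> and
      \<open>S - {f}\<close> would give \<open>2 + 1 \<le> 1 + 1\<close>.\<close>
    have "S - {e, f} = {}"
    proof (rule ccontr)
      assume "S - {e, f} \<noteq> {}"
      then have "1 \<le> r (S - {e, f})"
        using r_pos[of "S - {e, f}"] S by auto
      moreover have "r (S - {e} \<union> (S - {f})) + r ((S - {e}) \<inter> (S - {f})) \<le> r (S - {e}) + r (S - {f})"
        using S by (intro r_submodular) auto
      moreover have "S - {e} \<union> (S - {f}) = S" "(S - {e}) \<inter> (S - {f}) = S - {e, f}"
        using ef by auto
      ultimately show False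
        using drop[OF ef(1)] drop[OF ef(2)] rS by simp
    qed
    then have S_eq: "S = {e, f}"
      using ef by blast
    obtain b b' where b: "b \<in> B" "b' \<in> B" "b \<noteq> b'" "e \<in> matroid_closure E r {b, b'}"
      using triangle ef S unfolding triangle_matroid_def by blast
    \<comment> \<open>\<open>P\<close> spans a side of the triangle containing \<open>e\<close>.
      Once \<open>f\<close> is shown to lie on it too, \<open>P\<close> is the required subset of
      \<open>B\<close>.\<close>
    define P where "P = {b, b'}"
    have P: "P \<subseteq> B" "P \<subseteq> E" "r P = 2" "r (insert e P) = 2"
      using b r_subset_B[of P] B_E by (auto simp: P_def matroid_closure_def)
    have eP: "insert e P \<subseteq> E" "insert f P \<subseteq> E"
      using P ef S by auto
    have SP: "S \<union> P = insert e P \<union> insert f P"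
      unfolding S_eq by blast
    have "r (insert f P) = 2"
    proof (rule ccontr)
      assume "r (insert f P) \<noteq> 2"
      moreover have "2 \<le> r (insert f P)"
        using r_mono[of P "insert f P"] P eP by auto
      ultimately have "3 \<le> r (insert f P)"
        by linarith
      then have 3: "int c * 3 \<le> int c * r (insert f P)"
        by (intro mult_left_mono) auto
      have card1: "card (insert x P - B) \<le> 1" for x
      proof -
        have "insert x P - B \<subseteq> {x}"
          using P by blast
        then show ?thesis
          using card_mono[of "{x}" "insert x P - B"] by simp
      qed
      have fdA: "fin_dim_subspace scale (AA X)" if "X \<subseteq> E" for X
        using fin_dim_A that finite_E finite_subset by (intro fin_dim_arr_sum) blast+
      \<comment> \<open>If \<open>f\<close> is off this side, the four terms are at least
        \<open>3c\<close>, at least \<open>c\<close>, \<open>dim (AA S)\<close> and exactly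
        \<open>2c\<close>. Hence \<open>AA S\<close> has dimension at least \<open>2c\<close>,
        contradicting the positive defect. The exact values come from sets with at most one element
        outside \<open>B\<close>.\<close>
      have "dim (AA (S \<union> insert e P)) + dim (AA (S \<inter> insert e P)) \<le> dim (AA S) + dim (AA (insert e P))"
      proof (rule dim_arr_sum_submodular)
        show "finite S" "finite (insert e P)"
          using finite_subset[OF _ finite_E] S eP by auto
        show "fin_dim_subspace scale (A x)" if "x \<in> S \<union> insert e P" for x
          using that S eP by (intro fin_dim_A) auto
      qed
      moreover have "dim (AA {e}) \<le> dim (AA (S \<inter> insert e P))"
        using ef S by (intro dim_le_if_fin_dim fdA arr_sum_mono) auto
      moreover have "dim (AA (insert f P)) \<le> dim (AA (S \<union> insert e P))"
        using ef S eP by (intro dim_le_if_fin_dim fdA arr_sum_mono) auto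
      moreover have "int (dim (AA {e})) = int c"
        using dim_AA[of "{e}"] r_single[of e] ef S card_mono[of "{e}" "{e} - B"] by auto
      moreover have "int (dim (AA (insert e P))) = int c * 2"
        using dim_AA[OF eP(1) card1] P by simp
      moreover have "int (dim (AA (insert f P))) = int c * r (insert f P)"
        using dim_AA[OF eP(2) card1] by simp
      moreover have "dim (AA S) \<le> dim (UU S \<inter> UU B)"
        by (rule dim_le_if_fin_dim[OF fin_dim_UU_Int[OF S] AA_subset])
      ultimately have "int c * 2 \<le> int (dim (UU S \<inter> UU B))"
        using 3 by linarith
      then show False
        using pos rS unfolding defect_def by simp
    qed
    moreover have "r (insert e P \<union> insert f P) + r (insert e P \<inter> insert f P) \<le> r (insert e P) + r (insert f P)"
      using eP by (intro r_submodular)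
    moreover have "r P \<le> r (insert e P \<inter> insert f P)"
      using eP by (intro r_mono) auto
    moreover have "r S \<le> r (S \<union> P)"
      using S P by (intro r_mono) auto
    ultimately have "r (S \<union> P) = r S"
      using P rS SP by simp
    then show ?thesis
      using CM_nonemptyI[of S P] S ne P rS by simp
  qed
qed

text \<open>Comparing dimensions gives \<open>UU C = UU (S \<union> C) \<inter> UU B\<close>, so
  \<open>UU S \<inter> UU B\<close> lies in both \<open>UU X\<close> and \<open>UU C\<close>. Its
  dimension is that of \<open>UU C\<close> minus the defect, hence adding \<open>C\<close> gains at
  most the defect.\<close>

lemma dim_UU_Un_CM_le:
  assumes S: "S \<subseteq> E" and X: "S \<subseteq> X" "X \<subseteq> E" and C: "C \<subseteq> B" "r (S \<union> C) = r S" "r C = r S"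
  shows "int (dim (UU (X \<union> C))) \<le> int (dim (UU X)) + de S"
proof -
  have CE: "C \<subseteq> E"
    using C B_E by blast
  have "UU C = UU (S \<union> C) \<inter> UU B"
  proof (rule fin_dim_subspace_eqI)
    show "fin_dim_subspace scale (UU (S \<union> C) \<inter> UU B)"
      using fin_dim_UU_Int S CE by simp
    show "UU C \<subseteq> UU (S \<union> C) \<inter> UU B"
      using arr_sum_mono[of C "S \<union> C" U] arr_sum_mono[of C B U] C by blast
    show "subspace (UU C)"
      using fin_dim_UU CE fin_dim_subspace_subspace by blast
    show "dim (UU (S \<union> C) \<inter> UU B) \<le> dim (UU C)"
      using dim_Int_UU_B_le[of "S \<union> C"] dim_UU_subset_B[of C] S CE C by simp
  qed
  then have "UU S \<inter> UU B \<subseteq> UU C"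
    using arr_sum_mono[of S "S \<union> C" U] by blast
  moreover have "UU S \<inter> UU B \<subseteq> UU X"
    using arr_sum_mono[OF X(1)] by blast
  ultimately have "dim (UU (X \<union> C)) + dim (UU S \<inter> UU B) \<le> dim (UU X) + dim (UU C)"
    unfolding arr_sum_Un subspace_sum_def
    using fin_dim_UU fin_dim_UU_Int X CE S by (intro dim_span_Un_submodular) auto
  then show ?thesis
    using dim_UU_subset_B[OF C(1)] C unfolding defect_def by simp
qed

end

section \<open>The inflation\<close>

theorem theorem5p10:
  fixes sc :: "'f::field \<Rightarrow> 'v::ab_group_add \<Rightarrow> 'v"
    and c :: nat and E B S T Z :: "'e set" and r :: "'e set \<Rightarrow> int"
    and U :: "'e \<Rightarrow> 'v set"
    and U' :: "'e \<Rightarrow> (('v \<times> (nat \<Rightarrow> 'f)) \<times> (nat \<Rightarrow> 'f)) set"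
  assumes "infinite (UNIV :: 'f set)"
    and "vector_space sc"
    and "0 < c"
    and "triangle_matroid E r B"
    and "weak_rep_extension sc c E r B U"
    and "S \<subseteq> E - B"
    and "\<And>S'. S' \<subset> S \<Longrightarrow> full sc c r B U S'"
    and "inflation sc c E r B U S U'"
    and "T \<subseteq> E" and "T \<inter> S = {}" and "Z \<subseteq> S"
  shows "arr_rank (ext_scale (ext_scale sc)) c U' (T \<union> Z) =
    (if Z \<subset> S then arr_rank sc c U (T \<union> Z) + 2 * real (card Z)
     else arr_rank sc c U (T \<union> S \<union> CM r B S) + 2 * real (card S) - 1)"
proof -
  interpret triangle_extension sc c E B r U
    using assms by (simp add: triangle_extension_def triangle_extension_axioms_def)
  define sc1 where "sc1 = ext_scale sc"
  define C where "C = CM r B S"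
  define d where "d = nat (de S)"
  define n where "n = card S"
  interpret V1: vector_space sc1
    unfolding sc1_def using assms(2) by (rule vector_space_ext_scale)
  have S: "S \<subseteq> E"
    using assms(6) by auto
  have finS: "finite S"
    using S finite_E finite_subset by blast
  obtain U1 W' where
    EI1: "elementary_inflation sc c E U S (nat (int c * (int n - 1) + de S)) {0} U1"
    and W'gen: "if C = {} then W' = {0}
         else generic sc1 (subspaces_of_dim sc1 (arr_sum sc1 U1 C) d)
                {arr_sum sc1 U1 X |X. X \<subseteq> E} W'"
    and EI2: "elementary_inflation sc1 c E U1 S (c * n) W' U'"
    using assms(8) unfolding inflation_def Let_def sc1_def C_def d_def n_def by blast
  have deS: "0 \<le> de S" "de S = int d"
    using defect_nonneg[OF S] by (auto simp: d_def)
  \<comment> \<open>For \<open>|S| \<le> 1\<close> the first elementary inflation would need \<open>c\<close>-dimensional subspaces of the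
      zero space.\<close>
  have n2: "2 \<le> n"
  proof (rule ccontr)
    assume "\<not> 2 \<le> n"
    then consider "n = 0" | "n = 1"
      by linarith
    then have "int c * (int n - 1) + de S \<le> 0"
    proof cases
      case 1
      then show ?thesis
        using finS r_empty by (simp add: n_def defect_def)
    next
      case 2
      then obtain s where "S = {s}"
        unfolding n_def by (metis card_1_singletonE)
      then show ?thesis
        using 2 S defect_singleton by simp
    qed
    moreover have "c \<le> nat (int c * (int n - 1) + de S)"
      using EI1 unfolding elementary_inflation_def by simp
    ultimately show False
      using \<open>0 < c\<close> by simp
  qed
  then have "S \<noteq> {}"
    by (auto simp: n_def)
  then have d_le: "d \<le> c"
    using defect_le[OF S _ assms(7)] deS by simp
  have d1: "nat (int c * (int n - 1) + de S) = c * (n - 1) + d"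
  proof -
    have "int c * (int n - 1) + de S = int (c * (n - 1) + d)"
      using n2 deS by (simp add: of_nat_diff)
    then show ?thesis
      by (simp only: nat_int)
  qed
  have cn: "c * n = c * (n - 1) + c"
    using n2 by (cases n) auto
  have arrU: "subspace_arrangement sc E U"
    using fin_dim_U by (simp add: subspace_arrangement_def)
  have arrU1: "subspace_arrangement sc1 E U1"
    using elementary_inflation_dim(1)[OF assms(2) finite_E arrU S EI1] by (simp add: sc1_def)
  \<comment> \<open>In the first step the new subspaces meet the old space trivially, so the ceiling
    is just \<open>d1\<close> above \<open>dim (UU X)\<close>.\<close>
  have f1: "V1.dim (arr_sum sc1 U1 X) = dim (UU X) + min (c * card (X \<inter> S)) (c * (n - 1) + d)"
    if "X \<subseteq> E" for X
  proof -
    have "subspace_sum sc (UU X) {0} = UU X"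
      using fin_dim_UU[OF that] by (simp add: subspace_sum_def)
    moreover have "dim {0} = 0"
      using dim_unique[of "{}" "{0}" 0] independent_empty by simp
    ultimately show ?thesis
      using elementary_inflation_dim(2)[OF assms(2) finite_E arrU S EI1 that] d1
      by (simp add: sc1_def)
  qed
  have f2: "vector_space.dim (ext_scale sc1) (arr_sum (ext_scale sc1) U' X)
      = min (V1.dim (arr_sum sc1 U1 X) + c * card (X \<inter> S))
          (V1.dim (subspace_sum sc1 (arr_sum sc1 U1 X) W') + (c * n - V1.dim W'))"
    if "X \<subseteq> E" for X
    using elementary_inflation_dim(2)[OF V1.vector_space_axioms finite_E arrU1 S EI2 that] .
  have fdU1: "fin_dim_subspace sc1 (arr_sum sc1 U1 X)" if "X \<subseteq> E" for X
    using arrU1 that finite_E finite_subset unfolding subspace_arrangement_def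
    by (intro V1.fin_dim_arr_sum) blast+
  have CB: "C \<subseteq> B"
    using CM_nonemptyD(1)[of r B S] by (auto simp: C_def)
  then have CE: "C \<subseteq> E"
    using B_E by blast
  \<comment> \<open>This makes the default choice \<open>W' = {0}\<close> have the dimension
    \<open>d\<close> as well, so both cases share the formulas below.\<close>
  have d_0: "d = 0" if "C = {}"
    using CM_nonempty_if_defect_pos[OF S assms(7)] that n2 deS by (force simp: C_def n_def)
  have dimW': "V1.dim W' = d"
  proof (cases "C = {}")
    case True
    then show ?thesis
      using W'gen d_0 V1.dim_unique[of "{}" "{0}" 0] V1.independent_empty by simp
  next
    case False
    then show ?thesis
      using W'gen by (simp add: generic_def subspaces_of_dim_def)
  qed
  \<comment> \<open>\<open>W'\<close> is generic in the sum of \<open>U1\<close> over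
    \<open>C\<close>, so adding it gains \<open>d\<close> dimensions or absorbs that whole
    sum.\<close>
  have g: "V1.dim (subspace_sum sc1 (arr_sum sc1 U1 X) W')
      = min (V1.dim (arr_sum sc1 U1 X) + d) (V1.dim (arr_sum sc1 U1 (X \<union> C)))" if X: "X \<subseteq> E" for X
  proof (cases "C = {}")
    case True
    then show ?thesis
      using W'gen d_0 fdU1[OF X] by (simp add: subspace_sum_def)
  next
    case False
    then show ?thesis
      using W'gen V1.dim_sum_generic[OF fdU1[OF X] fdU1[OF CE]] X by (auto simp: V1.arr_sum_Un)
  qed
  have TE: "T \<union> Z \<subseteq> E"
    using assms S by blast
  have TZ: "(T \<union> Z) \<inter> S = Z"
    using assms by blast
  have mono: "V1.dim (arr_sum sc1 U1 X) \<le> V1.dim (arr_sum sc1 U1 (X \<union> C))" if "X \<subseteq> E" for X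
    using that CE by (intro V1.dim_le_if_fin_dim fdU1 V1.arr_sum_mono) auto
  show ?thesis
  proof (cases "Z \<subset> S")
    case True
    \<comment> \<open>With at most \<open>n - 1\<close> elements neither ceiling is reached: the
      first has room \<open>c * (n - 1) + d\<close>, the second at least \<open>c * (n - 1)\<close>
      because \<open>d \<le> c\<close>. Each step adds \<open>c * card Z\<close>.\<close>
    then have "card Z \<le> n - 1"
      using psubset_card_mono[OF finS True] by (simp add: n_def)
    then have cZ: "c * card Z \<le> c * (n - 1)"
      by simp
    have "V1.dim (arr_sum sc1 U1 (T \<union> Z)) = dim (UU (T \<union> Z)) + c * card Z"
      using f1[OF TE] cZ unfolding TZ by linarith
    moreover have "vector_space.dim (ext_scale sc1) (arr_sum (ext_scale sc1) U' (T \<union> Z))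
      = V1.dim (arr_sum sc1 U1 (T \<union> Z)) + c * card Z"
      using f2[OF TE] g[OF TE] mono[OF TE] cZ cn d_le unfolding TZ dimW' by linarith
    ultimately show ?thesis
      using True \<open>0 < c\<close> by (simp add: arr_rank_def sc1_def field_simps)
  next
    case False
    then have Z: "Z = S"
      using assms by blast
    have X: "T \<union> S \<subseteq> E" "T \<union> S \<union> C \<subseteq> E"
      using TE Z CE by auto
    have CS: "(T \<union> S \<union> C) \<inter> S = S"
      by blast
    \<comment> \<open>This settles the inner minimum below: \<open>d\<close> generic dimensions
      suffice to absorb \<open>C\<close>.\<close>
    have le: "dim (UU (T \<union> S \<union> C)) \<le> dim (UU (T \<union> S)) + d"
    proof (cases "C = {}")
      case False
      then have "int (dim (UU (T \<union> S \<union> C))) \<le> int (dim (UU (T \<union> S))) + de S"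
        using CM_nonemptyD[of r B S] S X by (intro dim_UU_Un_CM_le) (auto simp: C_def)
      then show ?thesis
        using deS by simp
    qed simp
    have min_n: "min (c * n) (c * (n - 1) + d) = c * (n - 1) + d"
      using cn d_le by simp
    have "V1.dim (arr_sum sc1 U1 (T \<union> S)) = dim (UU (T \<union> S)) + (c * (n - 1) + d)"
      "V1.dim (arr_sum sc1 U1 (T \<union> S \<union> C)) = dim (UU (T \<union> S \<union> C)) + (c * (n - 1) + d)"
      using f1[OF X(1)] f1[OF X(2)] CS TZ Z min_n by (simp_all add: n_def)
    moreover have "vector_space.dim (ext_scale sc1) (arr_sum (ext_scale sc1) U' (T \<union> S))
      = min (V1.dim (arr_sum sc1 U1 (T \<union> S)) + c * n)
          (min (V1.dim (arr_sum sc1 U1 (T \<union> S)) + d) (V1.dim (arr_sum sc1 U1 (T \<union> S \<union> C))) + (c * n - d))"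
      using f2[OF X(1)] g[OF X(1)] TZ Z dimW' by (simp add: n_def)
    \<comment> \<open>Now both ceilings are attained: the steps add \<open>c * (n - 1) + d\<close>
      and \<open>c * n - d\<close>, and \<open>d\<close> cancels. The summand \<open>c\<close> on
      the left avoids subtraction of natural numbers.\<close>
    ultimately have "vector_space.dim (ext_scale sc1) (arr_sum (ext_scale sc1) U' (T \<union> S)) + c
      = dim (UU (T \<union> S \<union> C)) + 2 * (c * n)"
      using le cn d_le by linarith
    then have "real (vector_space.dim (ext_scale sc1) (arr_sum (ext_scale sc1) U' (T \<union> S)) + c)
      = real (dim (UU (T \<union> S \<union> C)) + 2 * (c * n))"
      by (rule arg_cong)
    then have "real (vector_space.dim (ext_scale sc1) (arr_sum (ext_scale sc1) U' (T \<union> S)))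
      = real (dim (UU (T \<union> S \<union> C))) + 2 * (real c * real n) - real c"
      by simp
    then show ?thesis
      using Z \<open>0 < c\<close> by (simp add: arr_rank_def sc1_def C_def n_def field_simps)
  qed
qed

end
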